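(* Let $\dot A$ be a closed, densely defined symmetric operator with deficiency indices $(1,1)$ in a Hilbert space and let $A$ be a self-adjoint extension of $\dot A$. Denote by $M=M(\dot A,A)$ and by $s=s(\dot A,A)$ the Weyl–Titchmarsh function and the Livšic function associated with the pair $(\dot A,A)$, respectively. Then $$s(z)=\frac{M(z)-i}{M(z)+i},\qquad z\in\mathbb C_+ .$$
   Context: $\mathbb C_+$ is the open upper half-plane; inner products are linear in the first argument. Let $g_\pm\in\operatorname{Ker}((\dot A)^*\mp iI)$ be deficiency elements with $\|g_\pm\|=1$ and $g_+-g_-\in\operatorname{Dom}(A)$. Weyl–Titchmarsh function: $M(\dot A,A)(z)=((Az+I)(A-zI)^{-1}g_+,g_+)$, $z\in\mathbb C_+$. Livšic function: $$s(\dot A,A)(z)=\frac{z-i}{z+i}\cdot\frac{(g_z,g_-)}{(g_z,g_+)},\quad z\in\mathbb C_+,$$ where $0\ne g_z\in\operatorname{Ker}((\dot A)^*-zI)$ is an arbitrary element. *)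

theory Defs
  imports "HOL-Analysis.Analysis"
begin

text \<open>
  A complex Hilbert space is a complete real inner product space carrying a compatible complex
  scalar multiplication and a Hermitian form, linear in the \<^emph>\<open>first\<close> argument, whose real part is
  the given real inner product. As \<^term>\<open>cinner x x\<close> is then real, it is the square of
  \<^term>\<open>norm x\<close>; norm, topology and completeness are those of the library.
\<close>

class complex_hilbert_space = real_inner + complete_space +
  fixes scaleC :: "complex \<Rightarrow> 'a \<Rightarrow> 'a" (infixr "*\<^sub>C" 75)
    and cinner :: "'a \<Rightarrow> 'a \<Rightarrow> complex"
  assumes scaleC_add_right: "a *\<^sub>C (x + y) = a *\<^sub>C x + a *\<^sub>C y"
    and scaleC_add_left: "(a + b) *\<^sub>C x = a *\<^sub>C x + b *\<^sub>C x"
    and scaleC_scaleC: "a *\<^sub>C (b *\<^sub>C x) = (a * b) *\<^sub>C x"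
    and scaleC_of_real: "complex_of_real r *\<^sub>C x = r *\<^sub>R x"
    and cinner_commute: "cinner x y = cnj (cinner y x)"
    and cinner_add_left: "cinner (x + y) w = cinner x w + cinner y w"
    and cinner_scaleC_left: "cinner (a *\<^sub>C x) y = a * cinner x y"
    and Re_cinner: "Re (cinner x y) = inner x y"

instantiation complex :: complex_hilbert_space
begin

definition scaleC_complex_def: "a *\<^sub>C (x :: complex) = a * x"

definition cinner_complex_def: "cinner x (y :: complex) = x * cnj y"

instance
  by standard
    (auto simp: scaleC_complex_def cinner_complex_def inner_complex_def algebra_simps
       scaleR_conv_of_real)

end

global_interpretation complex_vector:
  vector_space "scaleC :: complex \<Rightarrow> 'a \<Rightarrow> 'a :: complex_hilbert_space"
proof
  show "1 *\<^sub>C x = x" for x :: 'a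
    using scaleC_of_real [of 1 x] by simp
qed (simp_all add: scaleC_add_right scaleC_add_left scaleC_scaleC)

text \<open>
  A not everywhere defined operator is a domain together with a function, whose values outside
  the domain are irrelevant; so equality of operators is mutual extension, not HOL equality.
\<close>

datatype 'a operator = Operator (Dom: "'a set") (app: "'a \<Rightarrow> 'a")

definition linear_operator :: "'a :: complex_hilbert_space operator \<Rightarrow> bool" where
  "linear_operator T \<longleftrightarrow>
     complex_vector.subspace (Dom T) \<and>
     (\<forall>x\<in>Dom T. \<forall>y\<in>Dom T. app T (x + y) = app T x + app T y) \<and>
     (\<forall>c. \<forall>x\<in>Dom T. app T (c *\<^sub>C x) = c *\<^sub>C app T x)"

definition densely_defined :: "'a :: complex_hilbert_space operator \<Rightarrow> bool" where
  "densely_defined T \<longleftrightarrow> closure (Dom T) = UNIV"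

definition closed_operator :: "'a :: complex_hilbert_space operator \<Rightarrow> bool" where
  "closed_operator T \<longleftrightarrow> closed ((\<lambda>x. (x, app T x)) ` Dom T)"

definition extends :: "'a operator \<Rightarrow> 'a operator \<Rightarrow> bool" where
  "extends B T \<longleftrightarrow> Dom T \<subseteq> Dom B \<and> (\<forall>x\<in>Dom T. app B x = app T x)"

definition symmetric_operator :: "'a :: complex_hilbert_space operator \<Rightarrow> bool" where
  "symmetric_operator T \<longleftrightarrow>
     (\<forall>x\<in>Dom T. \<forall>y\<in>Dom T. cinner (app T x) y = cinner x (app T y))"

text \<open>The value of the adjoint is unique, hence meaningful, for densely defined operators.\<close>

definition adjoint_op :: "'a :: complex_hilbert_space operator \<Rightarrow> 'a operator" where
  "adjoint_op T =
     Operator {y. \<exists>w. \<forall>x\<in>Dom T. cinner (app T x) y = cinner x w}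
              (\<lambda>y. THE w. \<forall>x\<in>Dom T. cinner (app T x) y = cinner x w)"

definition self_adjoint :: "'a :: complex_hilbert_space operator \<Rightarrow> bool" where
  "self_adjoint T \<longleftrightarrow>
     linear_operator T \<and> densely_defined T \<and>
     extends (adjoint_op T) T \<and> extends T (adjoint_op T)"

text \<open>\<open>Ker_shift T z\<close> is \<open>Ker (T - z I)\<close>.\<close>

definition Ker_shift :: "'a :: complex_hilbert_space operator \<Rightarrow> complex \<Rightarrow> 'a set" where
  "Ker_shift T z = {x \<in> Dom T. app T x - z *\<^sub>C x = 0}"

text \<open>
  The library dimension of an infinite-dimensional space is 0, so a deficiency index 0 here also
  covers the infinite case; positive values are genuine complex dimensions.
\<close>

definition deficiency_indices :: "'a :: complex_hilbert_space operator \<Rightarrow> nat \<times> nat" where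
  "deficiency_indices T =
     (complex_vector.dim (Ker_shift (adjoint_op T) \<i>),
      complex_vector.dim (Ker_shift (adjoint_op T) (- \<i>)))"

text \<open>\<open>resolvent T z\<close> is \<open>(T - z I)\<close> inverted as a map on \<open>Dom T\<close>.\<close>

definition resolvent :: "'a :: complex_hilbert_space operator \<Rightarrow> complex \<Rightarrow> 'a \<Rightarrow> 'a" where
  "resolvent T z = inv_into (Dom T) (\<lambda>x. app T x - z *\<^sub>C x)"

definition weyl_titchmarsh ::
    "'a :: complex_hilbert_space operator \<Rightarrow> 'a \<Rightarrow> complex \<Rightarrow> complex" where
  "weyl_titchmarsh A gp z =
     (let f = resolvent A z gp in cinner (z *\<^sub>C app A f + f) gp)"

text \<open>
  The definite description expresses that the defining element \<open>g\<close> is arbitrary: the value is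
  specified only if \<open>Ker (T* - z I)\<close> contains a nonzero \<open>g\<close> and all such \<open>g\<close> give the same number.
\<close>

definition livsic ::
    "'a :: complex_hilbert_space operator \<Rightarrow> 'a \<Rightarrow> 'a \<Rightarrow> complex \<Rightarrow> complex" where
  "livsic T gp gm z =
     (THE s. \<forall>g \<in> Ker_shift (adjoint_op T) z - {0}.
        s = (z - \<i>) / (z + \<i>) * (cinner g gm / cinner g gp))"

end

theory Submission
  imports Defs
begin

text \<open>
  Write \<open>T\<close> for the symmetric operator \<open>dotA\<close>. For \<open>Im z > 0\<close> put \<open>f = (A - z)\<inverse> g\<^sub>+\<close>; the vector
  \<open>g\<^sub>z = (A - i) f = g\<^sub>+ + (z - i) f\<close> is a nonzero element of \<open>Ker (T\<^sup>* - z)\<close>, so it may be used to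
  compute the Livsic function. Substituting \<open>A f = z f + g\<^sub>+\<close> into the Weyl-Titchmarsh function gives
  \<open>M(z) + i = (z + i) (g\<^sub>z, g\<^sub>+)\<close>. The condition \<open>g\<^sub>+ - g\<^sub>- \<in> Dom A\<close> links the two deficiency
  elements: since \<open>A \<subseteq> T\<^sup>*\<close>, it yields \<open>(A + i)(g\<^sub>+ - g\<^sub>-) = 2 i g\<^sub>+\<close>, and moving \<open>A + i\<close> to the
  other side of \<open>(f, (A + i)(g\<^sub>+ - g\<^sub>-))\<close> gives \<open>M(z) - i = (z - i) (g\<^sub>z, g\<^sub>-)\<close>. The quotient of the
  two identities is the assertion.

  Two facts of operator theory stand behind this computation. The first is that \<open>A - z\<close> is a
  bijection from \<open>Dom A\<close> onto the space when \<open>z\<close> is not real (\<open>self_adjoint_shift_surj\<close>): it is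
  bounded below by \<open>\<bar>Im z\<bar>\<close>, its range is closed, and the orthogonal complement of the range is an
  eigenspace of \<open>A\<close> for a nonreal eigenvalue; that a proper closed subspace has a nonzero orthogonal
  vector is the projection theorem, proved by minimizing the distance. The second is that the
  Livsic function does not depend on the chosen element, that is, that \<open>Ker (T\<^sup>* - z)\<close> is spanned by
  \<open>g\<^sub>z\<close>. For this, \<open>(A - z)(A - i)\<inverse>\<close> maps \<open>Ker (T\<^sup>* - z)\<close> into \<open>Ker (T\<^sup>* - i)\<close>
  (\<open>Ker_shift_transfer\<close>), which the deficiency index makes the line through \<open>g\<^sub>+\<close>, and its inverse
  \<open>(A - i)(A - z)\<inverse>\<close> takes \<open>g\<^sub>+\<close> to \<open>g\<^sub>z\<close>.
\<close>

section \<open>The projection theorem\<close>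

text \<open>
  For a minimizing sequence \<open>x\<close>, midpoints stay in the subspace, so by the parallelogram law
  \<open>norm (x m - x n)\<close> is controlled by how far both terms exceed the minimum; hence the
  sequence converges, and the error at its limit is orthogonal by the first variation.
\<close>

lemma closed_subspace_orthogonal_error:
  fixes S :: "'a :: {real_inner, complete_space} set"
  assumes S: "subspace S" and cl: "closed S"
  obtains p where "p \<in> S" "\<And>s. s \<in> S \<Longrightarrow> inner (y - p) s = 0"
proof -
  define D where "D = (\<lambda>s. (norm (y - s))\<^sup>2) ` S"
  define d where "d = Inf D"
  have D_ne: "D \<noteq> {}"
    unfolding D_def using subspace_0[OF S] by blast
  have D_bdd: "bdd_below D"
    unfolding D_def by (rule bdd_belowI[of _ 0]) auto
  have d_le: "d \<le> (norm (y - s))\<^sup>2" if "s \<in> S" for s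
    unfolding d_def by (rule cInf_lower[OF _ D_bdd]) (use that in \<open>auto simp: D_def\<close>)
  have "\<exists>s\<in>S. (norm (y - s))\<^sup>2 < d + 1 / real (Suc n)" for n
    using cInf_lessD[OF D_ne, of "d + 1 / real (Suc n)"] unfolding d_def D_def by auto
  then obtain x where xS: "\<And>n. x n \<in> S"
    and xd: "\<And>n. (norm (y - x n))\<^sup>2 < d + 1 / real (Suc n)"
    by metis
  have gap: "(norm (x m - x n))\<^sup>2 \<le> 2 / real (Suc m) + 2 / real (Suc n)" for m n
  proof -
    define c where "c = (1/2) *\<^sub>R (x m + x n)"
    have cS: "c \<in> S"
      unfolding c_def using S xS by (simp add: subspace_add subspace_scale)
    have "(norm (x m - x n))\<^sup>2 + 4 * (norm (y - c))\<^sup>2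
        = 2 * (norm (y - x m))\<^sup>2 + 2 * (norm (y - x n))\<^sup>2"
      unfolding c_def
      by (simp add: power2_norm_eq_inner inner_diff_left inner_diff_right inner_add_left
          inner_add_right inner_commute algebra_simps)
    then show ?thesis
      using d_le[OF cS] xd[of m] xd[of n] by simp
  qed
  have "Cauchy x"
  proof (rule metric_CauchyI)
    fix e :: real
    assume e: "0 < e"
    obtain N :: nat where N: "4 / e\<^sup>2 < real N"
      using reals_Archimedean2 by blast
    have eN: "4 / real (Suc N) < e\<^sup>2"
    proof -
      have "4 / e\<^sup>2 < real (Suc N)"
        using N by simp
      then show ?thesis
        using e by (simp add: field_simps)
    qed
    have "dist (x m) (x n) < e" if "N \<le> m" "N \<le> n" for m n
    proof -
      have "2 / real (Suc m) \<le> 2 / real (Suc N)" "2 / real (Suc n) \<le> 2 / real (Suc N)"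
        using that by (auto intro!: divide_left_mono)
      then have "(norm (x m - x n))\<^sup>2 < e\<^sup>2"
        using gap[of m n] eN by simp
      then show ?thesis
        using e by (simp add: dist_norm power2_less_imp_less)
    qed
    then show "\<exists>M. \<forall>m\<ge>M. \<forall>n\<ge>M. dist (x m) (x n) < e"
      by blast
  qed
  then obtain p where p: "x \<longlonglongrightarrow> p"
    using Cauchy_convergent_iff convergent_def by blast
  have pS: "p \<in> S"
    using closed_sequentially[OF cl xS p] .
  have p_min: "(norm (y - p))\<^sup>2 \<le> d"
  proof (rule LIMSEQ_le)
    show "(\<lambda>n. (norm (y - x n))\<^sup>2) \<longlonglongrightarrow> (norm (y - p))\<^sup>2"
      by (intro tendsto_intros p)
    show "(\<lambda>n. d + 1 / real (Suc n)) \<longlonglongrightarrow> d"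
      using tendsto_add[OF tendsto_const LIMSEQ_inverse_real_of_nat, of d]
      by (simp add: inverse_eq_divide)
    show "\<exists>N. \<forall>n\<ge>N. (norm (y - x n))\<^sup>2 \<le> d + 1 / real (Suc n)"
      using xd less_imp_le by blast
  qed
  have "inner (y - p) s = 0" if s: "s \<in> S" for s
  proof (cases "s = 0")
    case False
    define t where "t = inner (y - p) s / inner s s"
    have ss: "inner s s > 0"
      using False by simp
    have variation: "(norm (q - t *\<^sub>R s))\<^sup>2 =
        (norm q)\<^sup>2 - 2 * t * inner q s + t * t * inner s s" for q
      by (simp add: power2_norm_eq_inner inner_diff_left inner_diff_right inner_commute)
    have "p + t *\<^sub>R s \<in> S"
      using S pS s by (simp add: subspace_add subspace_scale)
    then have "(norm (y - p))\<^sup>2 \<le> (norm (y - (p + t *\<^sub>R s)))\<^sup>2"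
      using d_le[of "p + t *\<^sub>R s"] p_min by linarith
    also have "\<dots> = (norm ((y - p) - t *\<^sub>R s))\<^sup>2"
      by (simp add: algebra_simps)
    also have "\<dots> = (norm (y - p))\<^sup>2 - 2 * t * inner (y - p) s + t * t * inner s s"
    by (rule variation)
    also have "t * t * inner s s = t * inner (y - p) s"
      using ss by (simp add: t_def)
    finally have "t * inner (y - p) s \<le> 0"
      by simp
    then have "(inner (y - p) s)\<^sup>2 \<le> 0"
      using ss by (simp add: t_def power2_eq_square divide_le_0_iff)
    then show ?thesis
      by simp
  qed simp
  with pS show ?thesis
    by (rule that)
qed

section \<open>The Hermitian form\<close>

lemma cinner_add_right: "cinner x (y + w) = cinner x y + cinner x w"
  by (metis cinner_add_left cinner_commute complex_cnj_add)

lemma cinner_scaleC_right: "cinner x (a *\<^sub>C y) = cnj a * cinner x y"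
  by (metis cinner_scaleC_left cinner_commute complex_cnj_mult)

lemma cinner_diff_left: "cinner (x - y) w = cinner x w - cinner y w"
  by (metis add_diff_cancel cinner_add_left diff_add_cancel)

lemma cinner_diff_right: "cinner x (y - w) = cinner x y - cinner x w"
  by (metis add_diff_cancel cinner_add_right diff_add_cancel)

lemma cinner_zero_right [simp]: "cinner x 0 = 0"
  using cinner_diff_right[of x 0 0] by simp

lemma Im_cinner: "Im (cinner x y) = inner ((- \<i>) *\<^sub>C x) y"
  by (simp only: cinner_scaleC_left flip: Re_cinner) simp

lemma cinner_self: "cinner x x = complex_of_real ((norm x)\<^sup>2)"
proof -
  have "Im (cinner x x) = 0"
    using arg_cong[OF cinner_commute[of x x], of Im] by simp
  then show ?thesis
    by (simp add: complex_eq_iff Re_cinner power2_norm_eq_inner)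
qed

lemma norm_scaleC: "norm (a *\<^sub>C x) = cmod a * norm x"
proof -
  have "complex_of_real ((norm (a *\<^sub>C x))\<^sup>2) = (a * cnj a) * complex_of_real ((norm x)\<^sup>2)"
    by (simp only: cinner_scaleC_left cinner_scaleC_right ac_simps flip: cinner_self)
  then have "(norm (a *\<^sub>C x))\<^sup>2 = (cmod a * norm x)\<^sup>2"
    by (metis complex_norm_square of_real_eq_iff of_real_mult power_mult_distrib)
  then show ?thesis
    by (simp add: power2_eq_iff_nonneg)
qed

lemma abs_Im_cinner_le: "\<bar>Im (cinner x y)\<bar> \<le> norm x * norm y"
  using Cauchy_Schwarz_ineq2[of "(- \<i>) *\<^sub>C x" y] by (simp add: Im_cinner norm_scaleC)

lemma tendsto_scaleC:
  assumes "X \<longlonglongrightarrow> x"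
  shows "(\<lambda>n. a *\<^sub>C X n) \<longlonglongrightarrow> a *\<^sub>C x"
proof -
  have "(\<lambda>n. cmod a * norm (X n - x)) \<longlonglongrightarrow> cmod a * 0"
    by (intro tendsto_intros tendsto_norm_zero LIM_zero assms)
  moreover have "cmod a * norm (X n - x) = norm (a *\<^sub>C X n - a *\<^sub>C x)" for n
    by (simp add: complex_vector.scale_right_diff_distrib flip: norm_scaleC)
  ultimately have "(\<lambda>n. a *\<^sub>C X n - a *\<^sub>C x) \<longlonglongrightarrow> 0"
    by (simp add: tendsto_norm_zero_iff)
  then show ?thesis
    by (rule LIM_zero_cancel)
qed

lemma tendsto_cinner_right:
  assumes "X \<longlonglongrightarrow> x"
  shows "(\<lambda>n. cinner u (X n)) \<longlonglongrightarrow> cinner u x"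
  unfolding tendsto_complex_iff Re_cinner Im_cinner
  by (intro conjI tendsto_intros assms)

lemma complex_subspace_imp_subspace:
  assumes "complex_vector.subspace S"
  shows "subspace S"
  using assms unfolding subspace_def complex_vector.subspace_def
  by (metis scaleC_of_real)

text \<open>
  A subspace contains \<open>- i x\<close> together with \<open>x\<close>, so orthogonality for the real inner product
  already gives orthogonality for the Hermitian form.
\<close>

lemma closed_complex_subspace_eq_UNIV:
  fixes S :: "'a :: complex_hilbert_space set"
  assumes S: "complex_vector.subspace S" and "closed S"
    and triv: "\<And>y. (\<And>s. s \<in> S \<Longrightarrow> cinner s y = 0) \<Longrightarrow> y = 0"
  shows "S = UNIV"
proof -
  have "y \<in> S" for y
  proof -
    obtain p where p: "p \<in> S" and orth: "\<And>s. s \<in> S \<Longrightarrow> inner (y - p) s = 0"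
      using closed_subspace_orthogonal_error[OF complex_subspace_imp_subspace[OF S] \<open>closed S\<close>]
      by blast
    have "cinner s (y - p) = 0" if s: "s \<in> S" for s
    proof -
      have "(- \<i>) *\<^sub>C s \<in> S"
        using S s by (rule complex_vector.subspace_scale)
      then show ?thesis
        using orth[OF s] orth[of "(- \<i>) *\<^sub>C s"]
        by (simp only: complex_eq_iff Re_cinner Im_cinner inner_commute[of _ "y - p"]) simp
    qed
    then have "y - p = 0"
      by (rule triv)
    then show ?thesis
      using p by simp
  qed
  then show ?thesis
    by blast
qed

section \<open>Adjoints and self-adjoint operators\<close>

lemma dense_cinner_eq_imp_eq:
  fixes D :: "'a :: complex_hilbert_space set"
  assumes "closure D = UNIV" and "\<And>x. x \<in> D \<Longrightarrow> cinner x v = cinner x w"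
  shows "v = w"
proof -
  have "inner x (v - w) = 0" if "x \<in> D" for x
    using assms(2)[OF that] by (simp add: cinner_diff_right flip: Re_cinner)
  then have "D \<subseteq> {x. inner x (v - w) = 0}"
    by blast
  moreover have "closed {x. inner x (v - w) = 0}"
    by (intro closed_Collect_eq continuous_intros)
  ultimately have "closure D \<subseteq> {x. inner x (v - w) = 0}"
    by (rule closure_minimal)
  then have "inner (v - w) (v - w) = 0"
    using assms(1) by blast
  then show ?thesis
    by simp
qed

lemma adjoint_opI:
  assumes "densely_defined T"
    and adj: "\<And>x. x \<in> Dom T \<Longrightarrow> cinner (app T x) y = cinner x w"
  shows "y \<in> Dom (adjoint_op T)" and "app (adjoint_op T) y = w"
proof -
  show "y \<in> Dom (adjoint_op T)"
    using adj by (auto simp: adjoint_op_def)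
  have "v = w" if "\<forall>x\<in>Dom T. cinner (app T x) y = cinner x v" for v
    using dense_cinner_eq_imp_eq[of "Dom T" v w] assms that by (simp add: densely_defined_def)
  then show "app (adjoint_op T) y = w"
    using adj by (auto simp: adjoint_op_def intro!: the_equality)
qed

lemma cinner_adjoint_op:
  assumes "densely_defined T" and "y \<in> Dom (adjoint_op T)" and "x \<in> Dom T"
  shows "cinner (app T x) y = cinner x (app (adjoint_op T) y)"
proof -
  obtain w where w: "\<And>u. u \<in> Dom T \<Longrightarrow> cinner (app T u) y = cinner u w"
    using assms(2) by (auto simp: adjoint_op_def)
  show ?thesis
    using adjoint_opI(2)[OF assms(1) w] w[OF assms(3)] by simp
qed

lemma self_adjoint_symmetric:
  assumes "self_adjoint A" and "x \<in> Dom A" and "y \<in> Dom A"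
  shows "cinner (app A x) y = cinner x (app A y)"
proof -
  have "densely_defined A" and ext: "extends (adjoint_op A) A"
    using assms(1) unfolding self_adjoint_def by blast+
  moreover have "y \<in> Dom (adjoint_op A)" and "app (adjoint_op A) y = app A y"
    using ext assms(3) unfolding extends_def by blast+
  ultimately show ?thesis
    using cinner_adjoint_op[of A y x] assms(2) by simp
qed

lemma self_adjoint_maximal:
  assumes "self_adjoint A" and "\<And>x. x \<in> Dom A \<Longrightarrow> cinner (app A x) y = cinner x w"
  shows "y \<in> Dom A" and "app A y = w"
proof -
  have dense: "densely_defined A" and ext: "extends A (adjoint_op A)"
    using assms(1) unfolding self_adjoint_def by blast+
  have "y \<in> Dom (adjoint_op A)" and "app (adjoint_op A) y = w"
    using adjoint_opI[OF dense] assms(2) by blast+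
  with ext show "y \<in> Dom A" and "app A y = w"
    unfolding extends_def by auto
qed

lemma linear_operator_diff:
  assumes "linear_operator T" and "x \<in> Dom T" and "y \<in> Dom T"
  shows "x - y \<in> Dom T" and "app T (x - y) = app T x - app T y"
proof -
  have sub: "complex_vector.subspace (Dom T)"
    using assms(1) by (simp add: linear_operator_def)
  show d: "x - y \<in> Dom T"
    using sub assms(2,3) by (rule complex_vector.subspace_diff)
  have "app T ((x - y) + y) = app T (x - y) + app T y"
    using assms(1,3) d by (simp only: linear_operator_def)
  then show "app T (x - y) = app T x - app T y"
    by (simp add: algebra_simps)
qed

text \<open>
  The number \<open>(A x, x)\<close> is real, so the imaginary part of \<open>((A - z) x, x)\<close> is \<open>- Im z\<close> times
  the square of the norm of \<open>x\<close>.
\<close>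

lemma self_adjoint_shift_bound:
  assumes A: "self_adjoint A" and x: "x \<in> Dom A"
  shows "\<bar>Im z\<bar> * norm x \<le> norm (app A x - z *\<^sub>C x)"
proof (cases "x = 0")
  case False
  have "cinner (app A x) x = cnj (cinner (app A x) x)"
    by (subst self_adjoint_symmetric[OF A x x]) (rule cinner_commute)
  then have "Im (cinner (app A x) x) = 0"
    using Im_complex_of_real by (metis Reals_cnj_iff complex_is_Real_iff)
  then have "Im (cinner (app A x - z *\<^sub>C x) x) = - (Im z * (norm x)\<^sup>2)"
    by (simp add: cinner_diff_left cinner_scaleC_left cinner_self)
  then have "(\<bar>Im z\<bar> * norm x) * norm x \<le> norm (app A x - z *\<^sub>C x) * norm x"
    using abs_Im_cinner_le[of "app A x - z *\<^sub>C x" x]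
    by (simp add: abs_mult power2_eq_square)
  then show ?thesis
    by (rule mult_right_le_imp_le) (use False in simp)
qed simp

lemma self_adjoint_shift_inj:
  assumes A: "self_adjoint A" and z: "Im z \<noteq> 0" and x: "x \<in> Dom A" and y: "y \<in> Dom A"
    and eq: "app A x - z *\<^sub>C x = app A y - z *\<^sub>C y"
  shows "x = y"
proof -
  have lin: "linear_operator A"
    using A unfolding self_adjoint_def by blast
  have "app A (x - y) - z *\<^sub>C (x - y) = (app A x - z *\<^sub>C x) - (app A y - z *\<^sub>C y)"
    unfolding linear_operator_diff(2)[OF lin x y] complex_vector.scale_right_diff_distrib
    by (simp add: algebra_simps)
  also have "\<dots> = 0"
    using eq by simp
  finally have "app A (x - y) - z *\<^sub>C (x - y) = 0" .
  then have "\<bar>Im z\<bar> * norm (x - y) \<le> \<bar>Im z\<bar> * 0"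
    using self_adjoint_shift_bound[OF A linear_operator_diff(1)[OF lin x y], of z] by simp
  then have "norm (x - y) \<le> 0"
    by (rule mult_left_le_imp_le) (use z in simp)
  then show ?thesis
    by simp
qed

text \<open>
  The lower bound turns a convergent sequence in the range into a Cauchy sequence of preimages,
  whose limit is a preimage of the limit because a self-adjoint operator is closed.
\<close>

lemma self_adjoint_shift_closed_range:
  assumes A: "self_adjoint A" and z: "Im z \<noteq> 0"
  shows "closed ((\<lambda>x. app A x - z *\<^sub>C x) ` Dom A)"
  unfolding closed_sequential_limits
proof (intro allI impI)
  fix Y y
  assume asm: "(\<forall>n. Y n \<in> (\<lambda>x. app A x - z *\<^sub>C x) ` Dom A) \<and> Y \<longlonglongrightarrow> y"
  then have Y: "Y \<longlonglongrightarrow> y"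
    by (rule conjunct2)
  have "\<forall>n. \<exists>x\<in>Dom A. Y n = app A x - z *\<^sub>C x"
    using asm by blast
  then obtain X where X: "\<And>n. X n \<in> Dom A" and YX: "\<And>n. Y n = app A (X n) - z *\<^sub>C X n"
    by metis
  have lin: "linear_operator A"
    using A unfolding self_adjoint_def by blast
  have bound: "\<bar>Im z\<bar> * dist (X m) (X n) \<le> dist (Y m) (Y n)" for m n
    using self_adjoint_shift_bound[OF A linear_operator_diff(1)[OF lin X X], of z m n]
    by (simp add: dist_norm YX linear_operator_diff(2)[OF lin X X]
        complex_vector.scale_right_diff_distrib algebra_simps)
  have "Cauchy X"
  proof (rule metric_CauchyI)
    fix e :: real
    assume "0 < e"
    then have "0 < \<bar>Im z\<bar> * e"
      using z by simp
    then obtain N where N: "\<And>m n. N \<le> m \<Longrightarrow> N \<le> n \<Longrightarrow> dist (Y m) (Y n) < \<bar>Im z\<bar> * e"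
      using LIMSEQ_imp_Cauchy[OF Y] by (meson metric_CauchyD)
    have "dist (X m) (X n) < e" if "N \<le> m" "N \<le> n" for m n
    proof -
      have "\<bar>Im z\<bar> * dist (X m) (X n) < \<bar>Im z\<bar> * e"
        using bound[of m n] N[OF that] by simp
      then show ?thesis
        using z by simp
    qed
    then show "\<exists>M. \<forall>m\<ge>M. \<forall>n\<ge>M. dist (X m) (X n) < e"
      by blast
  qed
  then obtain x where x: "X \<longlonglongrightarrow> x"
    using Cauchy_convergent_iff convergent_def by blast
  have AX: "(\<lambda>n. app A (X n)) \<longlonglongrightarrow> y + z *\<^sub>C x"
    using tendsto_add[OF Y tendsto_scaleC[OF x, of z]] by (simp add: YX)
  have "cinner (app A u) x = cinner u (y + z *\<^sub>C x)" if u: "u \<in> Dom A" for u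
  proof (rule LIMSEQ_unique)
    show "(\<lambda>n. cinner (app A u) (X n)) \<longlonglongrightarrow> cinner (app A u) x"
      by (rule tendsto_cinner_right[OF x])
    show "(\<lambda>n. cinner (app A u) (X n)) \<longlonglongrightarrow> cinner u (y + z *\<^sub>C x)"
      using tendsto_cinner_right[OF AX, of u] by (simp add: self_adjoint_symmetric[OF A u X])
  qed
  then have "x \<in> Dom A" and "app A x = y + z *\<^sub>C x"
    using self_adjoint_maximal[OF A] by blast+
  then show "y \<in> (\<lambda>x. app A x - z *\<^sub>C x) ` Dom A"
    by (intro image_eqI[of _ _ x]) simp_all
qed

text \<open>
  By maximality of \<open>A\<close>, a vector orthogonal to the range of \<open>A - z\<close> lies in \<open>Dom A\<close> and in the
  kernel of \<open>A - cnj z\<close>, which is trivial because \<open>cnj z\<close> is not real either.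
\<close>

lemma self_adjoint_shift_surj:
  fixes A :: "'a :: complex_hilbert_space operator"
  assumes A: "self_adjoint A" and z: "Im z \<noteq> 0"
  shows "(\<lambda>x. app A x - z *\<^sub>C x) ` Dom A = UNIV"
proof (rule closed_complex_subspace_eq_UNIV)
  have lin: "linear_operator A"
    using A unfolding self_adjoint_def by blast
  then have D: "complex_vector.subspace (Dom A)"
    by (simp add: linear_operator_def)
  have D0: "0 \<in> Dom A"
    using D by (rule complex_vector.subspace_0)
  have A0: "app A 0 = 0"
    using linear_operator_diff(2)[OF lin D0 D0] by simp
  show "complex_vector.subspace ((\<lambda>x. app A x - z *\<^sub>C x) ` Dom A)"
  proof (rule complex_vector.subspaceI)
    show "0 \<in> (\<lambda>x. app A x - z *\<^sub>C x) ` Dom A"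
      using D0 A0 by (intro image_eqI[of _ _ 0]) simp_all
  next
    fix u v
    assume "u \<in> (\<lambda>x. app A x - z *\<^sub>C x) ` Dom A" "v \<in> (\<lambda>x. app A x - z *\<^sub>C x) ` Dom A"
    then obtain x y where xy: "x \<in> Dom A" "y \<in> Dom A"
      and uv: "u = app A x - z *\<^sub>C x" "v = app A y - z *\<^sub>C y"
      by blast
    have "x + y \<in> Dom A"
      using D xy by (rule complex_vector.subspace_add)
    moreover have "app A (x + y) = app A x + app A y"
      using lin xy by (simp add: linear_operator_def)
    ultimately show "u + v \<in> (\<lambda>x. app A x - z *\<^sub>C x) ` Dom A"
      by (intro image_eqI[of _ _ "x + y"]) (simp_all add: uv scaleC_add_right)
  next
    fix c u
    assume "u \<in> (\<lambda>x. app A x - z *\<^sub>C x) ` Dom A"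
    then obtain x where x: "x \<in> Dom A" and u: "u = app A x - z *\<^sub>C x"
      by blast
    have "c *\<^sub>C x \<in> Dom A"
      using D x by (rule complex_vector.subspace_scale)
    moreover have "app A (c *\<^sub>C x) = c *\<^sub>C app A x"
      using lin x by (simp add: linear_operator_def)
    ultimately show "c *\<^sub>C u \<in> (\<lambda>x. app A x - z *\<^sub>C x) ` Dom A"
      by (intro image_eqI[of _ _ "c *\<^sub>C x"])
        (simp_all add: u complex_vector.scale_right_diff_distrib scaleC_scaleC mult.commute)
  qed
  show "closed ((\<lambda>x. app A x - z *\<^sub>C x) ` Dom A)"
    using A z by (rule self_adjoint_shift_closed_range)
  fix y
  assume orth: "\<And>s. s \<in> (\<lambda>x. app A x - z *\<^sub>C x) ` Dom A \<Longrightarrow> cinner s y = 0"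
  have "cinner (app A x) y = cinner x (cnj z *\<^sub>C y)" if "x \<in> Dom A" for x
    using orth[OF imageI[OF that]]
    by (simp add: cinner_diff_left cinner_scaleC_left cinner_scaleC_right)
  then have y: "y \<in> Dom A" and Ay: "app A y = cnj z *\<^sub>C y"
    using self_adjoint_maximal[OF A] by blast+
  show "y = 0"
    by (rule self_adjoint_shift_inj[OF A _ y D0, of "cnj z"]) (use z Ay A0 in simp_all)
qed

lemma
  assumes "self_adjoint A" and "Im z \<noteq> 0"
  shows resolvent_in_Dom: "resolvent A z y \<in> Dom A"
    and app_resolvent: "app A (resolvent A z y) = y + z *\<^sub>C resolvent A z y"
proof -
  have y: "y \<in> (\<lambda>x. app A x - z *\<^sub>C x) ` Dom A"
    using self_adjoint_shift_surj[OF assms] by simp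
  show "resolvent A z y \<in> Dom A"
    unfolding resolvent_def using y by (rule inv_into_into)
  show "app A (resolvent A z y) = y + z *\<^sub>C resolvent A z y"
    unfolding resolvent_def using f_inv_into_f[OF y] by (simp add: algebra_simps)
qed

section \<open>Deficiency subspaces\<close>

lemma extends_imp_adjoint_op_extends:
  assumes T: "densely_defined T" and A: "self_adjoint A" and ext: "extends A T"
    and y: "y \<in> Dom A"
  shows "y \<in> Dom (adjoint_op T)" and "app (adjoint_op T) y = app A y"
proof -
  have "cinner (app T x) y = cinner x (app A y)" if x: "x \<in> Dom T" for x
  proof -
    have "x \<in> Dom A" "app A x = app T x"
      using ext x by (auto simp: extends_def)
    then show ?thesis
      using self_adjoint_symmetric[OF A _ y, of x] by simp
  qed
  then show "y \<in> Dom (adjoint_op T)" and "app (adjoint_op T) y = app A y"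
    using adjoint_opI[OF T] by blast+
qed

lemma Ker_shift_adjoint_op_iff:
  assumes T: "densely_defined T"
  shows "h \<in> Ker_shift (adjoint_op T) z \<longleftrightarrow>
    (\<forall>x\<in>Dom T. cinner (app T x) h = cinner x (z *\<^sub>C h))"
  using adjoint_opI[OF T, of h "z *\<^sub>C h"] cinner_adjoint_op[OF T, of h]
  by (fastforce simp: Ker_shift_def)

text \<open>
  The vector in the conclusion is \<open>(A - w)(A - z)\<inverse> h\<close>: the resolvent of any self-adjoint
  extension carries one deficiency subspace into another.
\<close>

lemma Ker_shift_transfer:
  assumes T: "densely_defined T" and A: "self_adjoint A" and ext: "extends A T"
    and z: "Im z \<noteq> 0" and h: "h \<in> Ker_shift (adjoint_op T) w"
  shows "h + (z - w) *\<^sub>C resolvent A z h \<in> Ker_shift (adjoint_op T) z"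
  unfolding Ker_shift_adjoint_op_iff[OF T]
proof
  fix x
  assume x: "x \<in> Dom T"
  define r where "r = resolvent A z h"
  have r: "r \<in> Dom A" and Ar: "app A r = h + z *\<^sub>C r"
    unfolding r_def using resolvent_in_Dom[OF A z] app_resolvent[OF A z] by blast+
  have xh: "cinner (app T x) h = cinner x (w *\<^sub>C h)"
    using h x by (simp add: Ker_shift_adjoint_op_iff[OF T])
  have xr: "cinner (app T x) r = cinner x (h + z *\<^sub>C r)"
    using cinner_adjoint_op[OF T extends_imp_adjoint_op_extends(1)[OF T A ext r] x]
    by (simp add: extends_imp_adjoint_op_extends(2)[OF T A ext r] Ar)
  have "cinner (app T x) (h + (z - w) *\<^sub>C r) = cinner x (z *\<^sub>C (h + (z - w) *\<^sub>C r))"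
    by (simp add: cinner_add_right cinner_scaleC_right xh xr) (simp add: algebra_simps)
  then show "cinner (app T x) (h + (z - w) *\<^sub>C resolvent A z h) =
      cinner x (z *\<^sub>C (h + (z - w) *\<^sub>C resolvent A z h))"
    by (simp add: r_def)
qed

lemma dim_1_imp_multiple:
  fixes V :: "'a :: complex_hilbert_space set"
  assumes dim: "complex_vector.dim V = 1" and v: "v \<in> V" "v \<noteq> 0" and u: "u \<in> V"
  obtains c where "u = c *\<^sub>C v"
proof -
  obtain B where "V \<subseteq> complex_vector.span B" and "card B = 1"
    using complex_vector.basis_exists[of V] dim by metis
  then obtain b where V: "V \<subseteq> complex_vector.span {b}"
    by (metis card_1_singletonE)
  obtain k l where k: "v = k *\<^sub>C b" and l: "u = l *\<^sub>C b"
    using V v(1) u unfolding complex_vector.span_singleton by blast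
  have "k \<noteq> 0"
    using k v(2) by auto
  then have "u = (l / k) *\<^sub>C v"
    by (simp add: k l scaleC_scaleC)
  then show ?thesis
    by (rule that)
qed

text \<open>
  Writing an arbitrary \<open>h\<close> of \<open>Ker (T\<^sup>* - z)\<close> as \<open>(A - i) u\<close>, the vector \<open>(A - z) u\<close> lies in
  \<open>Ker (T\<^sup>* - i)\<close>, so it is some \<open>c g = c (A - z) f\<close> with \<open>f = (A - z)\<inverse> g\<close>; injectivity gives
  \<open>u = c f\<close>, and applying \<open>A - i\<close> recovers \<open>h\<close>.
\<close>

lemma Ker_shift_multiple_of_transfer:
  assumes T: "densely_defined T" and A: "self_adjoint A" and ext: "extends A T"
    and dim: "complex_vector.dim (Ker_shift (adjoint_op T) \<i>) = 1"
    and g: "g \<in> Ker_shift (adjoint_op T) \<i>" "g \<noteq> 0"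
    and z: "Im z \<noteq> 0" and h: "h \<in> Ker_shift (adjoint_op T) z"
  obtains c where "h = c *\<^sub>C (g + (z - \<i>) *\<^sub>C resolvent A z g)"
proof -
  define u where "u = resolvent A \<i> h"
  define f where "f = resolvent A z g"
  have i: "Im \<i> \<noteq> 0"
    by simp
  have u: "u \<in> Dom A" and Au: "app A u = h + \<i> *\<^sub>C u"
    unfolding u_def using resolvent_in_Dom[OF A i] app_resolvent[OF A i] by blast+
  have f: "f \<in> Dom A" and Af: "app A f = g + z *\<^sub>C f"
    unfolding f_def using resolvent_in_Dom[OF A z] app_resolvent[OF A z] by blast+
  obtain c where c: "h + (\<i> - z) *\<^sub>C u = c *\<^sub>C g"
    using dim_1_imp_multiple[OF dim g Ker_shift_transfer[OF T A ext i h]] unfolding u_def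
    by blast
  have lin: "linear_operator A"
    using A unfolding self_adjoint_def by blast
  have cf: "c *\<^sub>C f \<in> Dom A"
    using lin f by (simp add: linear_operator_def complex_vector.subspace_scale)
  have Acf: "app A (c *\<^sub>C f) = c *\<^sub>C app A f"
    using lin f by (simp add: linear_operator_def)
  have "app A u - z *\<^sub>C u = c *\<^sub>C g"
    using c by (simp add: Au complex_vector.scale_left_diff_distrib algebra_simps)
  also have "\<dots> = app A (c *\<^sub>C f) - z *\<^sub>C (c *\<^sub>C f)"
    by (simp add: Acf Af scaleC_add_right scaleC_scaleC mult.commute)
  finally have "u = c *\<^sub>C f"
    by (rule self_adjoint_shift_inj[OF A z u cf])
  then have "h = c *\<^sub>C g + (c * (z - \<i>)) *\<^sub>C f"
    using c by (simp add: scaleC_scaleC algebra_simps complex_vector.scale_left_diff_distrib)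
  then have "h = c *\<^sub>C (g + (z - \<i>) *\<^sub>C f)"
    by (simp add: scaleC_add_right scaleC_scaleC)
  then show ?thesis
    unfolding f_def by (rule that)
qed

lemma transfer_nonzero:
  assumes A: "self_adjoint A" and z: "Im z \<noteq> 0" and g: "g \<noteq> 0"
  shows "g + (z - \<i>) *\<^sub>C resolvent A z g \<noteq> 0"
proof
  assume eq: "g + (z - \<i>) *\<^sub>C resolvent A z g = 0"
  define f where "f = resolvent A z g"
  have f: "f \<in> Dom A" and Af: "app A f = g + z *\<^sub>C f"
    unfolding f_def using resolvent_in_Dom[OF A z] app_resolvent[OF A z] by blast+
  \<comment> \<open>\<open>(A - i) f = 0\<close> forces \<open>f = 0\<close>, and then \<open>g = (A - z) f = 0\<close>.\<close>
  have "app A f - \<i> *\<^sub>C f = 0"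
    using eq unfolding Af complex_vector.scale_left_diff_distrib f_def[symmetric]
    by (simp only: add_diff_eq)
  then have "f = 0"
    using self_adjoint_shift_bound[OF A f, of \<i>] by simp
  then show False
    using eq g by (simp add: f_def)
qed

section \<open>The Livsic and Weyl-Titchmarsh functions\<close>

text \<open>
  The formula is homogeneous of degree 0 in the deficiency element, so on a one-dimensional
  deficiency subspace any nonzero element computes it.
\<close>

lemma livsic_eq:
  assumes g: "g \<in> Ker_shift (adjoint_op T) z" "g \<noteq> 0"
    and span: "\<And>h. h \<in> Ker_shift (adjoint_op T) z \<Longrightarrow> \<exists>c. h = c *\<^sub>C g"
  shows "livsic T gp gm z = (z - \<i>) / (z + \<i>) * (cinner g gm / cinner g gp)"
  unfolding livsic_def
proof (rule the_equality)
  have "cinner h gm / cinner h gp = cinner g gm / cinner g gp"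
    if h: "h \<in> Ker_shift (adjoint_op T) z - {0}" for h
  proof -
    obtain c where c: "h = c *\<^sub>C g"
      using span h by blast
    then have "c \<noteq> 0"
      using h by auto
    then show ?thesis
      by (simp add: c cinner_scaleC_left)
  qed
  then show "\<forall>h\<in>Ker_shift (adjoint_op T) z - {0}.
      (z - \<i>) / (z + \<i>) * (cinner g gm / cinner g gp) =
      (z - \<i>) / (z + \<i>) * (cinner h gm / cinner h gp)"
    by simp
next
  fix s
  assume "\<forall>h\<in>Ker_shift (adjoint_op T) z - {0}.
      s = (z - \<i>) / (z + \<i>) * (cinner h gm / cinner h gp)"
  then show "s = (z - \<i>) / (z + \<i>) * (cinner g gm / cinner g gp)"
    using g by blast
qed

lemma weyl_titchmarsh_plus_i:
  assumes A: "self_adjoint A" and z: "Im z \<noteq> 0" and "norm g = 1"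
  shows "weyl_titchmarsh A g z + \<i> =
    (z + \<i>) * cinner (g + (z - \<i>) *\<^sub>C resolvent A z g) g"
proof -
  have gg: "cinner g g = 1"
    using assms(3) by (simp add: cinner_self)
  show ?thesis
    by (simp add: weyl_titchmarsh_def Let_def app_resolvent[OF A z] cinner_add_left
        cinner_diff_left cinner_scaleC_left gg algebra_simps)
qed

text \<open>
  Here \<open>g\<^sub>+ - g\<^sub>- \<in> Dom A\<close> enters: \<open>(A + i)(g\<^sub>+ - g\<^sub>-) = 2 i g\<^sub>+\<close>, so testing against
  \<open>f = (A - z)\<inverse> g\<^sub>+\<close> expresses \<open>((A - i) f, g\<^sub>-)\<close> through \<open>(f, g\<^sub>+)\<close>.
\<close>

lemma weyl_titchmarsh_minus_i:
  assumes T: "densely_defined T" and A: "self_adjoint A" and ext: "extends A T"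
    and gp: "gp \<in> Ker_shift (adjoint_op T) \<i>" and "norm gp = 1"
    and gm: "gm \<in> Ker_shift (adjoint_op T) (- \<i>)"
    and d: "gp - gm \<in> Dom A" and z: "Im z \<noteq> 0"
  shows "weyl_titchmarsh A gp z - \<i> =
    (z - \<i>) * cinner (gp + (z - \<i>) *\<^sub>C resolvent A z gp) gm"
proof -
  define f where "f = resolvent A z gp"
  have f: "f \<in> Dom A" and Af: "app A f = gp + z *\<^sub>C f"
    unfolding f_def using resolvent_in_Dom[OF A z] app_resolvent[OF A z] by blast+
  have gg: "cinner gp gp = 1"
    using assms(5) by (simp add: cinner_self)
  have Ad: "app A (gp - gm) = \<i> *\<^sub>C gp + \<i> *\<^sub>C gm"
  proof -
    have "app (adjoint_op T) (gp - gm) = \<i> *\<^sub>C gp + \<i> *\<^sub>C gm"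
    proof (rule adjoint_opI(2)[OF T])
      fix x
      assume "x \<in> Dom T"
      then have "cinner (app T x) gp = cinner x (\<i> *\<^sub>C gp)"
        and "cinner (app T x) gm = cinner x ((- \<i>) *\<^sub>C gm)"
        using gp gm unfolding Ker_shift_adjoint_op_iff[OF T] by blast+
      then show "cinner (app T x) (gp - gm) = cinner x (\<i> *\<^sub>C gp + \<i> *\<^sub>C gm)"
        by (simp only: cinner_diff_right cinner_add_right cinner_scaleC_right) simp
    qed
    then show ?thesis
      using extends_imp_adjoint_op_extends(2)[OF T A ext d] by simp
  qed
  have "cinner (app A f) (gp - gm) = cinner f (app A (gp - gm))"
    by (rule self_adjoint_symmetric[OF A f d])
  then have key: "cinner gp gm + z * cinner f gm =
      1 + z * cinner f gp + \<i> * cinner f gp + \<i> * cinner f gm"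
    by (simp add: Af Ad cinner_add_left cinner_scaleC_left cinner_diff_right cinner_add_right
        cinner_scaleC_right gg algebra_simps)
  have gz: "cinner (gp + (z - \<i>) *\<^sub>C f) gm = 1 + (z + \<i>) * cinner f gp"
    unfolding cinner_add_left cinner_scaleC_left using key by (simp add: algebra_simps)
  have "weyl_titchmarsh A gp z = cinner (z *\<^sub>C (gp + z *\<^sub>C f) + f) gp"
    by (simp add: weyl_titchmarsh_def Let_def Af flip: f_def)
  also have "\<dots> = z * (1 + z * cinner f gp) + cinner f gp"
    by (simp add: cinner_add_left cinner_scaleC_left gg)
  finally show ?thesis
    unfolding f_def[symmetric] gz by (simp add: algebra_simps)
qed

theorem theorem2p1:
  fixes dotA A :: "'a :: complex_hilbert_space operator"
    and gp gm :: 'a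
  assumes "linear_operator dotA"
    and "closed_operator dotA"
    and "densely_defined dotA"
    and "symmetric_operator dotA"
    and "deficiency_indices dotA = (1, 1)"
    and "self_adjoint A"
    and "extends A dotA"
    and "gp \<in> Ker_shift (adjoint_op dotA) \<i>" and "norm gp = 1"
    and "gm \<in> Ker_shift (adjoint_op dotA) (- \<i>)" and "norm gm = 1"
    and "gp - gm \<in> Dom A"
  shows "\<forall>z. Im z > 0 \<longrightarrow>
    livsic dotA gp gm z = (weyl_titchmarsh A gp z - \<i>) / (weyl_titchmarsh A gp z + \<i>)"
proof (intro allI impI)
  fix z
  assume "Im z > 0"
  then have z: "Im z \<noteq> 0"
    by simp
  note T = \<open>densely_defined dotA\<close> and A = \<open>self_adjoint A\<close> and ext = \<open>extends A dotA\<close>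
  have gp0: "gp \<noteq> 0"
    using \<open>norm gp = 1\<close> by auto
  have dim: "complex_vector.dim (Ker_shift (adjoint_op dotA) \<i>) = 1"
    using assms(5) by (simp add: deficiency_indices_def)
  define gz where "gz = gp + (z - \<i>) *\<^sub>C resolvent A z gp"
  have "livsic dotA gp gm z = (z - \<i>) / (z + \<i>) * (cinner gz gm / cinner gz gp)"
  proof (rule livsic_eq)
    show "gz \<in> Ker_shift (adjoint_op dotA) z"
      unfolding gz_def using Ker_shift_transfer[OF T A ext z assms(8)] .
    show "gz \<noteq> 0"
      unfolding gz_def using A z gp0 by (rule transfer_nonzero)
    show "\<exists>c. h = c *\<^sub>C gz" if "h \<in> Ker_shift (adjoint_op dotA) z" for h
      unfolding gz_def
      using Ker_shift_multiple_of_transfer[OF T A ext dim assms(8) gp0 z that] by blast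
  qed
  \<comment> \<open>Division by zero is total, so a zero of \<open>(g\<^sub>z, g\<^sub>+)\<close> would make both sides vanish.\<close>
  also have "\<dots> = ((z - \<i>) * cinner gz gm) / ((z + \<i>) * cinner gz gp)"
    by simp
  also have "\<dots> = (weyl_titchmarsh A gp z - \<i>) / (weyl_titchmarsh A gp z + \<i>)"
    unfolding gz_def weyl_titchmarsh_plus_i[OF A z \<open>norm gp = 1\<close>]
      weyl_titchmarsh_minus_i[OF T A ext assms(8,9,10,12) z] ..
  finally show "livsic dotA gp gm z =
      (weyl_titchmarsh A gp z - \<i>) / (weyl_titchmarsh A gp z + \<i>)" .
qed

end
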